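(* Let $W$ be a weight matrix of size $N$. Suppose there exists an operator $C\in\mathcal D(W)$ such that $\Lambda_n(C)$ is a scalar matrix for every $n\ge0$ and such that $\Lambda_k(C)=\Lambda_j(C)$ only if $k=j$. Then $$C_{\mathbf D}(C)=\mathcal D(W).$$ In particular, $C_{\mathbf D}(\mathcal Z(W))=\mathcal D(W)$, where $\mathcal Z(W)$ is the center of $\mathcal D(W)$.
   Context: A weight matrix $W$ of size $N$ is an integrable complex $N\times N$ matrix-valued function on a real interval $(a,b)$ (possibly infinite) that is positive definite almost everywhere and has finite moments of all orders. $M_N$ denotes complex $N\times N$ matrices, $T^*$ the conjugate transpose. On $M_N[x]$ use the matrix-valued form $(P,Q)=\int_a^b P(x)W(x)Q(x)^*\,dx$; $\{Q_w\}_{w\ge0}$ is the unique sequence of monic orthogonal polynomials ($Q_w\in M_N[x]$ monic of degree $w$, $(Q_w,Q_{w'})=0$ for $w\ne w'$). The Weyl algebra over $M_N$ is $$\mathbf D=\Bigl\{D=\sum_{i=0}^s\partial^iF_i:\ F_i\in M_N[x]\Bigr\},\quad \partial=\tfrac{d}{dx},$$ whose elements act on $M_N[x]$ on the right by $PD=\sum_i\partial^i(P)F_i$, with product determined by $P(DE)=(PD)E$. Its subalgebra $\mathcal D(W)$ consists of the $D\in\mathbf D$ such that for every $w\ge0$ there is a (necessarily unique) $\Lambda_w(D)\in M_N$ with $Q_wD=\Lambda_w(D)Q_w$. For an element or subset $S$ of $\mathbf D$, $C_{\mathbf D}(S)$ denotes the centralizer of $S$ in $\mathbf D$. A scalar matrix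 is a complex multiple of the identity. *)

theory Defs
  imports "HOL-Analysis.Analysis" "HOL-Computational_Algebra.Polynomial"
begin

type_synonym 'n cmat = "complex ^ 'n ^ 'n"

text \<open>
  The ring \<open>M\<^sub>N[x]\<close>, as matrices with entries in \<open>\<complex>[x]\<close>. The size \<open>N\<close> is \<open>CARD('n)\<close>, and the
  ring product is \<open>**\<close> (the type class product on \<open>vec\<close> is entrywise and is not used).
\<close>
type_synonym 'n mpoly = "complex poly ^ 'n ^ 'n"

definition const_mpoly :: "'n::finite cmat \<Rightarrow> 'n mpoly" where
  "const_mpoly A = map_matrix (\<lambda>c. [:c:]) A"

definition mcoeff :: "'n::finite mpoly \<Rightarrow> nat \<Rightarrow> 'n cmat" where
  "mcoeff P m = map_matrix (\<lambda>p. coeff p m) P"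

definition meval :: "'n::finite mpoly \<Rightarrow> real \<Rightarrow> 'n cmat" where
  "meval P x = map_matrix (\<lambda>p. poly p (complex_of_real x)) P"

definition mderiv :: "'n::finite mpoly \<Rightarrow> 'n mpoly" where
  "mderiv P = map_matrix pderiv P"

definition monic_of_degree :: "nat \<Rightarrow> 'n::finite mpoly \<Rightarrow> bool" where
  "monic_of_degree w P \<longleftrightarrow> mcoeff P w = mat 1 \<and> (\<forall>m>w. mcoeff P m = 0)"

definition ctranspose :: "'n::finite cmat \<Rightarrow> 'n cmat" where
  "ctranspose A = map_matrix cnj (transpose A)"

definition scalar_matrix :: "'n::finite cmat \<Rightarrow> bool" where
  "scalar_matrix A \<longleftrightarrow> (\<exists>c. A = mat c)"

definition pos_def :: "'n::finite cmat \<Rightarrow> bool" where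
  "pos_def A \<longleftrightarrow> ctranspose A = A \<and>
     (\<forall>v. v \<noteq> 0 \<longrightarrow> 0 < Re (\<Sum>i\<in>UNIV. cnj (v $ i) * (A *v v) $ i))"


text \<open>Integrability is in the sense of Lebesgue; the case \<open>n = 0\<close> is the integrability of \<open>W\<close>.\<close>

definition weight_matrix :: "ereal \<Rightarrow> ereal \<Rightarrow> (real \<Rightarrow> 'n::finite cmat) \<Rightarrow> bool" where
  "weight_matrix a b W \<longleftrightarrow> a < b \<and>
     (AE x in lebesgue. x \<in> einterval a b \<longrightarrow> pos_def (W x)) \<and>
     (\<forall>n. set_integrable lebesgue (einterval a b) (\<lambda>x. x ^ n *\<^sub>R W x))"

definition mform :: "ereal \<Rightarrow> ereal \<Rightarrow> (real \<Rightarrow> 'n::finite cmat) \<Rightarrow> 'n mpoly \<Rightarrow> 'n mpoly \<Rightarrow> 'n cmat" where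
  "mform a b W P Q =
     set_lebesgue_integral lebesgue (einterval a b)
       (\<lambda>x. meval P x ** W x ** ctranspose (meval Q x))"

definition monic_orthogonal ::
    "ereal \<Rightarrow> ereal \<Rightarrow> (real \<Rightarrow> 'n::finite cmat) \<Rightarrow> (nat \<Rightarrow> 'n mpoly) \<Rightarrow> bool" where
  "monic_orthogonal a b W Q \<longleftrightarrow>
     (\<forall>w. monic_of_degree w (Q w)) \<and> (\<forall>w w'. w \<noteq> w' \<longrightarrow> mform a b W (Q w) (Q w') = 0)"

definition mop :: "ereal \<Rightarrow> ereal \<Rightarrow> (real \<Rightarrow> 'n::finite cmat) \<Rightarrow> nat \<Rightarrow> 'n mpoly" where
  "mop a b W = (THE Q. monic_orthogonal a b W Q)"


text \<open>
  An element \<open>\<Sum>i\<le>s. \<partial>\<^sup>i F\<^sub>i\<close> of the Weyl algebra over \<open>M\<^sub>N\<close> is represented by its right action on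
  \<open>M\<^sub>N[x]\<close>, so that \<open>PD\<close> is written \<open>D P\<close>. By \<open>weyl_op_coeffs_unique\<close> below this action determines
  the \<open>F\<^sub>i\<close>.
\<close>

type_synonym 'n operator = "'n mpoly \<Rightarrow> 'n mpoly"

definition weyl_op :: "nat \<Rightarrow> (nat \<Rightarrow> 'n::finite mpoly) \<Rightarrow> 'n operator" where
  "weyl_op s F = (\<lambda>P. \<Sum>i\<le>s. (mderiv ^^ i) P ** F i)"

definition weyl_algebra :: "'n::finite operator set" where
  "weyl_algebra = {D. \<exists>s F. D = weyl_op s F}"

text \<open>The action is on the right, \<open>P(DE) = (PD)E\<close>: the left factor acts first.\<close>

definition weyl_mult :: "'n::finite operator \<Rightarrow> 'n operator \<Rightarrow> 'n operator" where
  "weyl_mult D E = (\<lambda>P. E (D P))"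

definition weyl_centralizer :: "'n::finite operator set \<Rightarrow> 'n operator set" where
  "weyl_centralizer S = {D \<in> weyl_algebra. \<forall>E\<in>S. weyl_mult D E = weyl_mult E D}"

definition DW :: "ereal \<Rightarrow> ereal \<Rightarrow> (real \<Rightarrow> 'n::finite cmat) \<Rightarrow> 'n operator set" where
  "DW a b W = {D \<in> weyl_algebra. \<forall>w. \<exists>L. D (mop a b W w) = const_mpoly L ** mop a b W w}"

definition Lam :: "ereal \<Rightarrow> ereal \<Rightarrow> (real \<Rightarrow> 'n::finite cmat) \<Rightarrow> nat \<Rightarrow> 'n operator \<Rightarrow> 'n cmat" where
  "Lam a b W w D = (THE L. D (mop a b W w) = const_mpoly L ** mop a b W w)"

definition ZW :: "ereal \<Rightarrow> ereal \<Rightarrow> (real \<Rightarrow> 'n::finite cmat) \<Rightarrow> 'n operator set" where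
  "ZW a b W = {D \<in> DW a b W. \<forall>E\<in>DW a b W. weyl_mult D E = weyl_mult E D}"


lemma mderiv_funpow_nth: "(mderiv ^^ i) P $ k $ l = (pderiv ^^ i) (P $ k $ l)"
  by (induction i) (simp_all add: mderiv_def)

lemma pderiv_funpow_monom:
  "\<exists>c::complex. c \<noteq> 0 \<and> (pderiv ^^ i) (monom 1 m) = (if i \<le> m then monom c (m - i) else 0)"
proof (induction i)
  case 0
  show ?case by (auto intro: exI[of _ 1])
next
  case (Suc i)
  then obtain c :: complex where "c \<noteq> 0"
    and c: "(pderiv ^^ i) (monom 1 m) = (if i \<le> m then monom c (m - i) else 0)" by blast
  show ?case
  proof (cases "Suc i \<le> m")
    case True
    then show ?thesis using c \<open>c \<noteq> 0\<close>
      by (intro exI[of _ "of_nat (m - i) * c"]) (auto simp: pderiv_monom)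
  next
    case False
    then show ?thesis using c by (intro exI[of _ 1]) (auto simp: pderiv_monom)
  qed
qed

lemma mderiv_funpow_mat:
  "(mderiv ^^ i) (mat p :: 'n::finite mpoly) = mat ((pderiv ^^ i) p)"
proof -
  have "(pderiv ^^ i) 0 = (0 :: complex poly)" by (induction i) simp_all
  then show ?thesis by (simp add: vec_eq_iff mderiv_funpow_nth mat_def)
qed

lemma mat_mult_nth: "(mat c ** A) $ k $ l = c * (A :: 'n::finite mpoly) $ k $ l"
  by (simp add: matrix_matrix_mult_def mat_def if_distrib[of "\<lambda>x. x * _"] cong: if_cong)

lemma weyl_op_coeffs_unique:
  fixes F G :: "nat \<Rightarrow> 'n::finite mpoly"
  assumes eq: "weyl_op s F = weyl_op s G" and "m \<le> s"
  shows "F m = G m"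
  using \<open>m \<le> s\<close>
proof (induction m rule: less_induct)
  case (less m)
  define d where "d i = (pderiv ^^ i) (monom 1 m :: complex poly)" for i
  have d0: "d i = 0" if "i > m" for i
    using pderiv_funpow_monom[of i m] that by (auto simp: d_def)
  have dm: "d m \<noteq> 0"
    using pderiv_funpow_monom[of m m] by (auto simp: d_def)
  have split: "weyl_op s H (mat (monom 1 m)) = (\<Sum>i<m. mat (d i) ** H i) + mat (d m) ** H m"
    for H :: "nat \<Rightarrow> 'n mpoly"
  proof -
    have "weyl_op s H (mat (monom 1 m)) = (\<Sum>i\<le>s. mat (d i) ** H i)"
      by (simp add: weyl_op_def mderiv_funpow_mat d_def)
    also have "\<dots> = (\<Sum>i\<le>m. mat (d i) ** H i)"
      using less.prems
      by (intro sum.mono_neutral_right) (auto simp: d0 vec_eq_iff mat_mult_nth)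
    finally show ?thesis by (simp add: lessThan_Suc_atMost[symmetric])
  qed
  have "(\<Sum>i<m. mat (d i) ** F i) = (\<Sum>i<m. mat (d i) ** G i)"
    using less by (intro sum.cong) auto
  then have "mat (d m) ** F m = mat (d m) ** G m"
    using split[of F] split[of G] eq by simp
  then have "d m * F m $ k $ l = d m * G m $ k $ l" for k l
    by (metis mat_mult_nth)
  then show ?case using dm by (simp add: vec_eq_iff)
qed

end

theory Submission
  imports Defs
begin

text \<open>
  The form is definite: if \<open>(P, P) = 0\<close> then every row of \<open>P\<close> vanishes almost everywhere, so \<open>P = 0\<close>.
  Hence \<open>(P, P)\<close> is invertible for monic \<open>P\<close>, and Gram-Schmidt over \<open>M\<^sub>N\<close> gives the existence and
  uniqueness of the \<open>Q\<^sub>n\<close>, which form a basis of the left module \<open>M\<^sub>N[x]\<close>. Weyl operators are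
  left-linear and thus determined by their values on this basis. Scalar eigenvalues commute with
  all \<open>\<Lambda>\<^sub>n(D)\<close>, so \<open>C\<close> commutes with \<open>\<D>(W)\<close>. Conversely, if \<open>D\<close> commutes with \<open>C\<close> and
  \<open>Q\<^sub>n D = \<Sum>\<^sub>j A\<^sub>j Q\<^sub>j\<close>, then \<open>(\<lambda>\<^sub>j - \<lambda>\<^sub>n) A\<^sub>j = 0\<close>, and distinctness leaves only the term \<open>j = n\<close>.
\<close>

section \<open>Matrix polynomials\<close>

lemma matrix_add_rdistrib: "(A + B) ** C = A ** C + B ** (C :: 'a::semiring_1 ^ 'm ^ 'n)"
  by (simp add: vec_eq_iff matrix_matrix_mult_def distrib_right sum.distrib)

lemma matrix_diff_rdistrib: "(A - B) ** C = A ** C - B ** (C :: 'a::ring_1 ^ 'm ^ 'n)"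
  by (simp add: vec_eq_iff matrix_matrix_mult_def left_diff_distrib sum_subtractf)

lemma matrix_sum_rdistrib:
  fixes A :: "'b \<Rightarrow> 'a::semiring_1 ^ 'm ^ 'n"
  shows "(\<Sum>i\<in>S. A i) ** B = (\<Sum>i\<in>S. A i ** B)"
  by (induction S rule: infinite_finite_induct) (simp_all add: matrix_add_rdistrib)

lemma matrix_sum_ldistrib:
  fixes A :: "'b \<Rightarrow> 'a::semiring_1 ^ 'm ^ 'n"
  shows "B ** (\<Sum>i\<in>S. A i) = (\<Sum>i\<in>S. B ** A i)"
  by (induction S rule: infinite_finite_induct) (simp_all add: matrix_add_ldistrib)

lemma mcoeff_add: "mcoeff (P + Q) m = mcoeff P m + mcoeff Q m"
  by (simp add: mcoeff_def vec_eq_iff)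

lemma mcoeff_diff: "mcoeff (P - Q) m = mcoeff P m - mcoeff Q m"
  by (simp add: mcoeff_def vec_eq_iff)

lemma mcoeff_0 [simp]: "mcoeff 0 m = 0"
  by (simp add: mcoeff_def vec_eq_iff)

lemma mcoeff_sum: "mcoeff (\<Sum>i\<in>S. P i) m = (\<Sum>i\<in>S. mcoeff (P i) m)"
  by (induction S rule: infinite_finite_induct) (simp_all add: mcoeff_add)

lemma mcoeff_const_mult: "mcoeff (const_mpoly A ** P) m = A ** mcoeff P m"
  by (simp add: mcoeff_def const_mpoly_def vec_eq_iff matrix_matrix_mult_def coeff_sum)

lemma mcoeff_eqI: "(\<And>m. mcoeff P m = mcoeff Q m) \<Longrightarrow> P = Q"
  by (auto simp: mcoeff_def vec_eq_iff poly_eq_iff)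

lemma mcoeff_mat_monom: "mcoeff (mat (monom 1 w)) m = (if m = w then mat 1 else 0)"
  by (auto simp: mcoeff_def mat_def vec_eq_iff)

lemma const_mpoly_mult: "const_mpoly (A ** B) = const_mpoly A ** const_mpoly B"
proof -
  have const_sum: "[:\<Sum>k\<in>S. f k:] = (\<Sum>k\<in>S. [:f k:])" for f :: "'a \<Rightarrow> complex" and S
    by (rule poly_eqI) (simp add: coeff_sum coeff_pCons split: nat.split)
  show ?thesis
    by (simp add: const_mpoly_def vec_eq_iff matrix_matrix_mult_def const_sum mult.commute)
qed

lemma const_mpoly_0 [simp]: "const_mpoly 0 = 0"
  by (simp add: const_mpoly_def vec_eq_iff)

lemma const_mpoly_diff: "const_mpoly (A - B) = const_mpoly A - const_mpoly B"
  by (simp add: const_mpoly_def vec_eq_iff)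

lemma mat_commute: "mat c ** A = A ** mat (c :: 'a::comm_semiring_1)"
  by (simp add: vec_eq_iff matrix_matrix_mult_def mat_def if_distrib if_distribR mult.commute cong: if_cong)

lemma mat_mult_eq_0:
  fixes A :: "'a::idom ^ 'n ^ 'm"
  assumes "mat c ** A = 0" "c \<noteq> 0"
  shows "A = 0"
  using assms
  by (simp add: vec_eq_iff matrix_matrix_mult_def mat_def if_distrib if_distribR cong: if_cong)

section \<open>Monic sequences as bases of the left module of matrix polynomials\<close>

lemma finite_mdegree: "\<exists>w. \<forall>m\<ge>w. mcoeff P m = 0"
proof -
  define w where "w = Suc (Max ((\<lambda>(i, j). degree (P $ i $ j)) ` UNIV))"
  have "degree (P $ i $ j) < w" for i j
    unfolding w_def less_Suc_eq_le by (rule Max_ge) (auto intro!: image_eqI[of _ _ "(i, j)"])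
  then have "coeff (P $ i $ j) m = 0" if "m \<ge> w" for i j m
    using that by (meson coeff_eq_0 less_le_trans)
  then have "\<forall>m\<ge>w. mcoeff P m = 0"
    by (simp add: mcoeff_def vec_eq_iff)
  then show ?thesis by blast
qed

text \<open>Division from the top degree: the leading coefficient of \<open>Q w\<close> is the
  identity, so subtracting \<open>const_mpoly (mcoeff P w) ** Q w\<close> cancels degree
  \<open>w\<close> exactly. Constants stay on the left, the side on which the form and the operators
  are linear.\<close>

lemma monic_expansion:
  assumes "\<forall>j<w. monic_of_degree j (Q j)" and "\<forall>m\<ge>w. mcoeff P m = 0"
  shows "\<exists>A. P = (\<Sum>j<w. const_mpoly (A j) ** Q j)"
  using assms
proof (induction w arbitrary: P)
  case 0
  then show ?case by (auto intro: mcoeff_eqI)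
next
  case (Suc w)
  let ?R = "P - const_mpoly (mcoeff P w) ** Q w"
  have "\<forall>m\<ge>w. mcoeff ?R m = 0"
  proof safe
    fix m assume "w \<le> m"
    then show "mcoeff ?R m = 0"
      using Suc.prems by (cases "m = w") (auto simp: mcoeff_diff mcoeff_const_mult monic_of_degree_def)
  qed
  then obtain A where "?R = (\<Sum>j<w. const_mpoly (A j) ** Q j)"
    using Suc.IH[of ?R] Suc.prems(1) less_SucI by blast
  then have "P = (\<Sum>j<w. const_mpoly (A j) ** Q j) + const_mpoly (mcoeff P w) ** Q w"
    by (metis diff_add_cancel)
  then have "P = (\<Sum>j<Suc w. const_mpoly ((A(w := mcoeff P w)) j) ** Q j)"
    by simp
  then show ?case by blast
qed

text \<open>In degree \<open>w\<close> only the last summand contributes, and it contributes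
  \<open>A w\<close>. Once \<open>A w\<close> is zero, the shorter sum vanishes as well and the
  argument descends.\<close>

lemma monic_independent:
  assumes "\<forall>j<w. monic_of_degree j (Q j)"
    and "(\<Sum>j<w. const_mpoly (A j) ** Q j) = 0" and "j < w"
  shows "A j = 0"
  using assms
proof (induction w arbitrary: j)
  case (Suc w)
  have "0 = mcoeff (\<Sum>j<Suc w. const_mpoly (A j) ** Q j) w"
    using Suc.prems by simp
  also have "\<dots> = (\<Sum>j<w. A j ** mcoeff (Q j) w) + A w ** mcoeff (Q w) w"
    by (simp add: mcoeff_add mcoeff_sum mcoeff_const_mult)
  also have "\<dots> = A w"
    using Suc.prems(1) by (auto simp: monic_of_degree_def intro!: sum.neutral)
  finally have "A w = 0" ..
  moreover from this have "A j = 0" if "j < w" for j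
    using Suc.IH[OF _ _ that] Suc.prems(1,2) by simp
  ultimately show ?case
    using Suc.prems(3) by (auto simp: less_Suc_eq)
qed simp

lemma monic_const_mult_cancel:
  assumes "monic_of_degree w Q" "const_mpoly A ** Q = const_mpoly B ** Q"
  shows "A = B"
  using assms by (metis mcoeff_const_mult monic_of_degree_def matrix_mul_rid)

section \<open>Evaluation at real points and conjugate transposes\<close>

lemma meval_eq_sum:
  assumes "\<forall>m\<ge>w. mcoeff P m = 0"
  shows "meval P x = (\<Sum>m<w. x ^ m *\<^sub>R mcoeff P m)"
proof -
  have "poly (P $ i $ j) (of_real x) = (\<Sum>m<w. x ^ m *\<^sub>R coeff (P $ i $ j) m)" for i j
  proof -
    have *: "coeff (P $ i $ j) m = 0" if "m \<ge> w" for m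
      using assms that by (auto simp: mcoeff_def vec_eq_iff)
    have "poly (P $ i $ j) (of_real x) = (\<Sum>m\<le>degree (P $ i $ j). coeff (P $ i $ j) m * of_real x ^ m)"
      by (rule poly_altdef)
    \<comment> \<open>\<open>w\<close> and the degree of a single entry are not comparable in
      general, so the sum is first padded to the larger bound and then cut back to
      \<open>w\<close>.\<close>
    also have "\<dots> = (\<Sum>m<max w (Suc (degree (P $ i $ j))). coeff (P $ i $ j) m * of_real x ^ m)"
      by (rule sum.mono_neutral_left) (auto simp: coeff_eq_0)
    also have "\<dots> = (\<Sum>m<w. coeff (P $ i $ j) m * of_real x ^ m)"
      by (rule sum.mono_neutral_right) (auto simp: *)
    finally show ?thesis by (simp add: scaleR_conv_of_real mult.commute)
  qed
  then show ?thesis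
    by (simp add: vec_eq_iff meval_def mcoeff_def)
qed

lemma meval_add: "meval (P + Q) x = meval P x + meval Q x"
  by (simp add: meval_def vec_eq_iff)

lemma meval_const_mult: "meval (const_mpoly A ** P) x = A ** meval P x"
  by (simp add: meval_def const_mpoly_def vec_eq_iff matrix_matrix_mult_def poly_sum)

lemma ctranspose_mult: "ctranspose (A ** B) = ctranspose B ** ctranspose A"
  by (simp add: ctranspose_def vec_eq_iff matrix_matrix_mult_def transpose_def mult.commute)

lemma ctranspose_ctranspose [simp]: "ctranspose (ctranspose A) = A"
  by (simp add: ctranspose_def vec_eq_iff transpose_def)

lemma ctranspose_add: "ctranspose (A + B) = ctranspose A + ctranspose B"
  by (simp add: ctranspose_def vec_eq_iff transpose_def)

lemma ctranspose_scaleR: "ctranspose (c *\<^sub>R A) = c *\<^sub>R ctranspose A"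
  by (simp add: ctranspose_def vec_eq_iff transpose_def)

lemma ctranspose_0 [simp]: "ctranspose 0 = 0"
  by (simp add: ctranspose_def vec_eq_iff transpose_def)

lemma ctranspose_eq_0_iff [simp]: "ctranspose A = 0 \<longleftrightarrow> A = 0"
  by (metis ctranspose_0 ctranspose_ctranspose)

lemma ctranspose_sum: "ctranspose (\<Sum>i\<in>S. A i) = (\<Sum>i\<in>S. ctranspose (A i))"
  by (induction S rule: infinite_finite_induct) (simp_all add: ctranspose_add)

lemma bounded_linear_ctranspose: "bounded_linear ctranspose"
  by (intro linear_conv_bounded_linear[THEN iffD1] linearI) (simp_all add: ctranspose_add ctranspose_scaleR)

lemma scaleR_matrix_mult_left: "(c *\<^sub>R A) ** B = c *\<^sub>R (A ** (B :: complex ^ 'm ^ 'n::finite))"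
  by (simp add: vec_eq_iff matrix_matrix_mult_def scaleR_sum_right)

lemma scaleR_matrix_mult_right: "A ** (c *\<^sub>R B) = c *\<^sub>R (A ** (B :: complex ^ 'm ^ 'n::finite))"
  by (simp add: vec_eq_iff matrix_matrix_mult_def scaleR_sum_right)

text \<open>Lets constant matrices on both sides pass through the Bochner integral.\<close>

lemma bounded_linear_matrix_mult:
  "bounded_linear (\<lambda>X :: 'n::finite cmat. A ** X ** B)"
  by (intro linear_conv_bounded_linear[THEN iffD1] linearI)
     (simp_all add: matrix_add_ldistrib matrix_add_rdistrib scaleR_matrix_mult_left scaleR_matrix_mult_right)

section \<open>Singular and positive definite matrices\<close>

lemma not_invertible_annihilated:
  fixes A :: "'n::finite cmat"
  assumes "\<not> invertible A"
  shows "\<exists>X :: 'n cmat. X \<noteq> 0 \<and> A ** X = 0"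
proof -
  obtain v where v: "A *v v = 0" "v \<noteq> 0"
    using assms unfolding invertible_left_inverse matrix_left_invertible_ker by blast
  \<comment> \<open>Every column is the same kernel vector, which turns it into a square
    matrix.\<close>
  define X :: "'n cmat" where "X = (\<chi> i j. v $ i)"
  have "A ** X = 0"
    using v(1) by (simp add: vec_eq_iff matrix_matrix_mult_def matrix_vector_mult_def X_def)
  moreover have "X \<noteq> 0"
    using v(2) by (auto simp: vec_eq_iff X_def)
  ultimately show ?thesis by blast
qed

text \<open>Diagonal entries of a congruence are values of the quadratic form of \<open>A\<close>.
  The vector is the conjugated row of \<open>M\<close>, so that the right-hand side has literally
  the shape used in \<open>pos_def\<close>.\<close>

lemma diagonal_congruence:
  fixes M A :: "'n::finite cmat"
  shows "(M ** A ** ctranspose M) $ i $ i =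
    (\<Sum>k\<in>UNIV. cnj ((\<chi> k. cnj (M $ i $ k)) $ k) * (A *v (\<chi> k. cnj (M $ i $ k))) $ k)"
  by (subst matrix_mul_assoc[symmetric])
     (simp add: matrix_matrix_mult_def matrix_vector_mult_def ctranspose_def transpose_def)

lemma pos_def_diagonal:
  assumes "pos_def A"
  shows "0 \<le> Re ((M ** A ** ctranspose M) $ i $ i)"
    and "Re ((M ** A ** ctranspose M) $ i $ i) = 0 \<Longrightarrow> M $ i $ k = 0"
proof -
  define v where "v = (\<chi> k. cnj (M $ i $ k))"
  have pos: "v \<noteq> 0 \<Longrightarrow> 0 < Re ((M ** A ** ctranspose M) $ i $ i)"
    using assms unfolding diagonal_congruence v_def[symmetric] pos_def_def by blast
  have zero: "v = 0 \<Longrightarrow> Re ((M ** A ** ctranspose M) $ i $ i) = 0"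
    unfolding diagonal_congruence v_def[symmetric] by simp
  show "0 \<le> Re ((M ** A ** ctranspose M) $ i $ i)"
    using pos zero by (cases "v = 0") auto
  show "M $ i $ k = 0" if "Re ((M ** A ** ctranspose M) $ i $ i) = 0"
  proof -
    have "v = 0" using pos that by auto
    then have "v $ k = 0" by simp
    then show ?thesis by (simp add: v_def)
  qed
qed

section \<open>The matrix-valued form of a weight\<close>

text \<open>A nonzero polynomial has finitely many roots, which form a null set, whereas a nonempty
  open set is not negligible.\<close>

lemma poly_AE_zero_on_open:
  fixes p :: "complex poly"
  assumes "open S" "S \<noteq> {}"
    and "AE x in lebesgue. x \<in> S \<longrightarrow> poly p (of_real x) = 0"
  shows "p = 0"
proof (rule ccontr)
  assume "p \<noteq> 0"
  then have "finite {z. poly p z = 0}" by (rule poly_roots_finite)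
  then have "finite (of_real -` {z. poly p z = 0} :: real set)"
    by (rule finite_vimageI) (simp add: inj_on_def)
  then have "negligible (of_real -` {z. poly p z = 0} :: real set)"
    by (rule negligible_finite)
  then have "AE x in lebesgue. x \<notin> (of_real -` {z. poly p z = 0} :: real set)"
    unfolding negligible_iff_null_sets by (rule AE_not_in)
  with assms(3) have "AE x in lebesgue. x \<notin> S"
    by eventually_elim auto
  then have "negligible S"
    by (simp add: AE_iff_null_sets negligible_iff_null_sets assms(1) borel_open)
  then show False
    using open_not_negligible assms(1,2) by blast
qed

context
  fixes a b :: ereal and W :: "real \<Rightarrow> 'n::finite cmat"
  assumes weight: "weight_matrix a b W"
begin

lemma AE_pos_def: "AE x in lebesgue. x \<in> einterval a b \<longrightarrow> pos_def (W x)"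
  using weight by (simp add: weight_matrix_def)

text \<open>Expanding both polynomials in powers of \<open>x\<close> leaves finitely many moments of
  \<open>W\<close>, each between two constant matrices.\<close>

lemma mform_integrable:
  "set_integrable lebesgue (einterval a b) (\<lambda>x. meval P x ** W x ** ctranspose (meval Q x))"
proof -
  obtain p q where p: "\<forall>m\<ge>p. mcoeff P m = 0" and q: "\<forall>m\<ge>q. mcoeff Q m = 0"
    using finite_mdegree by metis
  have expand: "meval P x ** W x ** ctranspose (meval Q x) =
      (\<Sum>m<p. \<Sum>n<q. mcoeff P m ** (x ^ (m + n) *\<^sub>R W x) ** ctranspose (mcoeff Q n))" for x
    unfolding meval_eq_sum[OF p] meval_eq_sum[OF q] ctranspose_sum ctranspose_scaleR
      matrix_sum_rdistrib
    by (simp add: matrix_sum_ldistrib scaleR_matrix_mult_left scaleR_matrix_mult_right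
        power_add mult.commute)
  have "set_integrable lebesgue (einterval a b)
      (\<lambda>x. mcoeff P m ** (x ^ (m + n) *\<^sub>R W x) ** ctranspose (mcoeff Q n))" for m n
  proof -
    have "set_integrable lebesgue (einterval a b) (\<lambda>x. x ^ (m + n) *\<^sub>R W x)"
      using weight by (simp add: weight_matrix_def)
    from integrable_bounded_linear[OF bounded_linear_matrix_mult this[unfolded set_integrable_def]]
    show ?thesis
      by (simp add: set_integrable_def scaleR_matrix_mult_left scaleR_matrix_mult_right)
  qed
  then show ?thesis
    unfolding expand set_integrable_def scaleR_sum_right
    by (intro Bochner_Integration.integrable_sum)
qed

lemma mform_add: "mform a b W (P + P') Q = mform a b W P Q + mform a b W P' Q"
  unfolding mform_def meval_add matrix_add_rdistrib
  by (rule set_integral_add(2)[OF mform_integrable mform_integrable])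

lemma mform_const_mult: "mform a b W (const_mpoly A ** P) Q = A ** mform a b W P Q"
proof -
  \<comment> \<open>The right factor \<open>mat 1\<close> is inserted only to fit the two-sided
    \<open>bounded_linear_matrix_mult\<close>.\<close>
  have "(LINT x|lebesgue. A ** (indicator (einterval a b) x *\<^sub>R
          (meval P x ** W x ** ctranspose (meval Q x))) ** mat 1) = A ** mform a b W P Q ** mat 1"
    unfolding mform_def set_lebesgue_integral_def
    by (rule integral_bounded_linear[OF bounded_linear_matrix_mult
          mform_integrable[unfolded set_integrable_def]])
  then show ?thesis
    unfolding mform_def set_lebesgue_integral_def meval_const_mult
    by (simp only: matrix_mul_rid scaleR_matrix_mult_right matrix_mul_assoc)
qed

lemma mform_0: "mform a b W 0 Q = 0"
  using mform_const_mult[of 0 0 Q] by simp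

lemma mform_sum: "mform a b W (\<Sum>i\<in>S. P i) Q = (\<Sum>i\<in>S. mform a b W (P i) Q)"
  by (induction S rule: infinite_finite_induct) (simp_all add: mform_add mform_0)

lemma mform_diff: "mform a b W (P - P') Q = mform a b W P Q - mform a b W P' Q"
  using mform_add[of "P - P'" P' Q] by simp

text \<open>The adjoint passes under the integral and swaps the outer factors; \<open>W x\<close> is
  Hermitian almost everywhere, being positive definite there.\<close>

lemma ctranspose_mform: "ctranspose (mform a b W P Q) = mform a b W Q P"
proof -
  let ?I = "\<lambda>P Q x. indicator (einterval a b) x *\<^sub>R (meval P x ** W x ** ctranspose (meval Q x))"
  have int: "integrable lebesgue (?I P Q)" for P Q
    using mform_integrable[unfolded set_integrable_def] .
  have "ctranspose (mform a b W P Q) = (LINT x|lebesgue. ctranspose (?I P Q x))"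
    unfolding mform_def set_lebesgue_integral_def
    by (rule integral_bounded_linear[OF bounded_linear_ctranspose int, symmetric])
  also have "\<dots> = (LINT x|lebesgue. ?I Q P x)"
  proof (rule integral_cong_AE)
    show "(\<lambda>x. ctranspose (?I P Q x)) \<in> borel_measurable lebesgue"
      using integrable_bounded_linear[OF bounded_linear_ctranspose int] by (rule borel_measurable_integrable)
    show "?I Q P \<in> borel_measurable lebesgue"
      using int by (rule borel_measurable_integrable)
    show "AE x in lebesgue. ctranspose (?I P Q x) = ?I Q P x"
      using AE_pos_def
      by eventually_elim
         (auto simp: indicator_def pos_def_def ctranspose_mult matrix_mul_assoc)
  qed
  finally show ?thesis by (simp add: mform_def set_lebesgue_integral_def)
qed

text \<open>Real parts of diagonal entries reduce the claim to scalar integrals: each integrand is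
  nonnegative almost everywhere and has integral zero, so it vanishes almost everywhere. By
  \<open>pos_def_diagonal\<close> the corresponding row of \<open>P\<close> vanishes too.\<close>

lemma mform_definite:
  assumes "mform a b W P P = 0"
  shows "P = 0"
proof -
  let ?F = "\<lambda>x. meval P x ** W x ** ctranspose (meval P x)"
  have "open (einterval a b)" "einterval a b \<noteq> {}"
    using weight ereal_dense2[of a b] by (auto simp: weight_matrix_def einterval_iff open_einterval)
  moreover have "AE x in lebesgue. x \<in> einterval a b \<longrightarrow> poly (P $ i $ k) (of_real x) = 0" for i k
  proof -
    have bl: "bounded_linear (\<lambda>A :: 'n cmat. Re (A $ i $ i))"
      by (intro bounded_linear_compose[OF bounded_linear_Re]
          bounded_linear_compose[OF bounded_linear_vec_nth] bounded_linear_vec_nth)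
    note int = mform_integrable[of P P, unfolded set_integrable_def]
    have nonneg: "AE x in lebesgue. 0 \<le> Re ((indicator (einterval a b) x *\<^sub>R ?F x) $ i $ i)"
      using AE_pos_def by eventually_elim (auto simp: indicator_def pos_def_diagonal)
    have "(LINT x|lebesgue. Re ((indicator (einterval a b) x *\<^sub>R ?F x) $ i $ i)) = 0"
      using integral_bounded_linear[OF bl int] assms
      by (simp add: mform_def set_lebesgue_integral_def)
    then have "AE x in lebesgue. Re ((indicator (einterval a b) x *\<^sub>R ?F x) $ i $ i) = 0"
      using integral_nonneg_eq_0_iff_AE[OF integrable_bounded_linear[OF bl int] nonneg] by blast
    with AE_pos_def show ?thesis
    proof eventually_elim
      case (elim x)
      then show ?case
        using pos_def_diagonal(2)[of "W x" "meval P x" i k] by (auto simp: meval_def)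
    qed
  qed
  ultimately have "P $ i $ k = 0" for i k
    by (rule poly_AE_zero_on_open)
  then show ?thesis by (simp add: vec_eq_iff)
qed

text \<open>If \<open>X\<close> is nonzero and is annihilated by \<open>(P,P)\<close> from the left,
  then \<open>R = X* P\<close> satisfies \<open>(R,R) = X* (P,P) X = 0\<close>. Definiteness gives
  \<open>R = 0\<close>, although its leading coefficient is \<open>X*\<close>.\<close>

lemma invertible_mform_monic:
  assumes "monic_of_degree w P"
  shows "invertible (mform a b W P P)"
proof (rule ccontr)
  assume "\<not> invertible (mform a b W P P)"
  then obtain X :: "'n cmat" where X: "X \<noteq> 0" "mform a b W P P ** X = 0"
    using not_invertible_annihilated by blast
  let ?R = "const_mpoly (ctranspose X) ** P"
  \<comment> \<open>Conjugate linearity in the second argument follows by taking adjoints in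
    \<open>mform_const_mult\<close>.\<close>
  have "mform a b W P ?R = mform a b W P P ** X"
    using arg_cong[OF mform_const_mult[of "ctranspose X" P P], of ctranspose]
    by (simp add: ctranspose_mform ctranspose_mult)
  then have "mform a b W ?R ?R = 0"
    by (simp add: mform_const_mult X(2))
  then have "?R = 0" by (rule mform_definite)
  then have "mcoeff ?R w = 0" by simp
  then show False
    using assms X(1) by (simp add: mcoeff_const_mult monic_of_degree_def)
qed

lemma mform_monic_cancel:
  assumes "monic_of_degree w P" "A ** mform a b W P P = 0"
  shows "A = 0"
  using invertible_mform_monic[OF assms(1)] assms(2)
  by (metis invertible_def matrix_mul_assoc matrix_mul_rid times0_left)

lemma mform_orthogonal_sym: "mform a b W P Q = 0 \<Longrightarrow> mform a b W Q P = 0"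
  by (metis ctranspose_mform ctranspose_0)

section \<open>Gram-Schmidt: existence and uniqueness of the orthogonal polynomials\<close>

lemma mform_orthogonal_expansion:
  assumes "finite S" "i \<in> S" "\<And>j. j \<in> S \<Longrightarrow> j \<noteq> i \<Longrightarrow> mform a b W (Q j) (Q i) = 0"
  shows "mform a b W (\<Sum>j\<in>S. const_mpoly (A j) ** Q j) (Q i) = A i ** mform a b W (Q i) (Q i)"
proof -
  have "(\<Sum>j\<in>S. A j ** mform a b W (Q j) (Q i)) = (\<Sum>j\<in>{i}. A j ** mform a b W (Q j) (Q i))"
    using assms by (intro sum.mono_neutral_right) auto
  then show ?thesis by (simp add: mform_sum mform_const_mult)
qed

text \<open>Orthogonality is required against all polynomials of lower degree, not against earlier
  choices. The property thus concerns one degree at a time, and witnesses for different degrees may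
  be chosen independently.\<close>

lemma ex_monic_orthogonal_to_lower:
  "\<exists>P. monic_of_degree w P \<and> (\<forall>R. (\<forall>m\<ge>w. mcoeff R m = 0) \<longrightarrow> mform a b W R P = 0)"
proof (induction w rule: less_induct)
  case (less w)
  then obtain Q where Q: "\<And>j. j < w \<Longrightarrow> monic_of_degree j (Q j)"
    and orth: "\<And>j R. j < w \<Longrightarrow> \<forall>m\<ge>j. mcoeff R m = 0 \<Longrightarrow> mform a b W R (Q j) = 0"
    by metis
  have "mform a b W (Q i) (Q j) = 0" if "i < j" "j < w" for i j
    using that Q[of i] by (intro orth) (auto simp: monic_of_degree_def)
  then have QQ: "mform a b W (Q i) (Q j) = 0" if "i \<noteq> j" "i < w" "j < w" for i j
    using that mform_orthogonal_sym by (metis linorder_neq_iff)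
  \<comment> \<open>These are the matrix Fourier coefficients of \<open>x^w\<close>; they exist
    because \<open>(Q j, Q j)\<close> is invertible.\<close>
  have "\<exists>B. B ** mform a b W (Q j) (Q j) = mform a b W (mat (monom 1 w)) (Q j)" if "j < w" for j
    using invertible_mform_monic[OF Q[OF that]]
    by (metis invertible_def matrix_mul_assoc matrix_mul_rid)
  then obtain B where B: "\<And>j. j < w \<Longrightarrow>
      B j ** mform a b W (Q j) (Q j) = mform a b W (mat (monom 1 w)) (Q j)"
    by metis
  define P where "P = mat (monom 1 w) - (\<Sum>j<w. const_mpoly (B j) ** Q j)"
  have "mcoeff (\<Sum>j<w. const_mpoly (B j) ** Q j) m = 0" if "m \<ge> w" for m
    using that Q by (auto simp: mcoeff_sum mcoeff_const_mult monic_of_degree_def intro!: sum.neutral)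
  then have monic: "monic_of_degree w P"
    by (auto simp: monic_of_degree_def P_def mcoeff_diff mcoeff_mat_monom)
  have PQ: "mform a b W P (Q j) = 0" if "j < w" for j
    using that unfolding P_def
    by (subst mform_diff, subst mform_orthogonal_expansion) (auto simp: QQ B)
  have "mform a b W R P = 0" if R: "\<forall>m\<ge>w. mcoeff R m = 0" for R
  proof -
    obtain A where "R = (\<Sum>j<w. const_mpoly (A j) ** Q j)"
      using monic_expansion[OF _ R] Q by blast
    then show ?thesis
      using PQ by (simp add: mform_sum mform_const_mult mform_orthogonal_sym)
  qed
  with monic show ?case by blast
qed

lemma ex_monic_orthogonal: "\<exists>Q. monic_orthogonal a b W Q"
proof -
  obtain Q where Q: "\<And>w. monic_of_degree w (Q w)"
    and orth: "\<And>w R. \<forall>m\<ge>w. mcoeff R m = 0 \<Longrightarrow> mform a b W R (Q w) = 0"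
    using ex_monic_orthogonal_to_lower by metis
  have "mform a b W (Q i) (Q j) = 0" if "i < j" for i j
    using that Q[of i] by (intro orth) (auto simp: monic_of_degree_def)
  then have "mform a b W (Q i) (Q j) = 0" if "i \<noteq> j" for i j
    using that mform_orthogonal_sym by (metis linorder_neq_iff)
  with Q show ?thesis
    unfolding monic_orthogonal_def by blast
qed

text \<open>The leading terms cancel, so the difference lies in the span of the \<open>Q j\<close>
  with \<open>j < w\<close>. It is orthogonal to each of them, hence all its coefficients
  vanish.\<close>

lemma monic_orthogonal_unique:
  assumes "monic_orthogonal a b W Q" "monic_orthogonal a b W Q'"
  shows "Q w = Q' w"
proof (induction w rule: less_induct)
  case (less w)
  let ?R = "Q w - Q' w"
  have "\<forall>m\<ge>w. mcoeff ?R m = 0"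
  proof safe
    fix m assume "w \<le> m"
    then show "mcoeff ?R m = 0"
      using assms
      by (cases "m = w") (auto simp: mcoeff_diff monic_orthogonal_def monic_of_degree_def)
  qed
  then obtain A where A: "?R = (\<Sum>j<w. const_mpoly (A j) ** Q j)"
    using monic_expansion[of w Q ?R] assms(1) unfolding monic_orthogonal_def by blast
  have "A j = 0" if "j < w" for j
  proof -
    \<comment> \<open>The induction hypothesis replaces \<open>Q j\<close> by \<open>Q' j\<close> in
      the second form, where orthogonality of the primed sequence applies.\<close>
    have "mform a b W ?R (Q j) = mform a b W (Q w) (Q j) - mform a b W (Q' w) (Q' j)"
      using less that by (simp add: mform_diff)
    also have "\<dots> = 0"
      using assms that by (simp add: monic_orthogonal_def)
    finally have "A j ** mform a b W (Q j) (Q j) = 0"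
      using that assms(1) unfolding A
      by (subst (asm) mform_orthogonal_expansion) (auto simp: monic_orthogonal_def)
    then show ?thesis
      using mform_monic_cancel assms(1) by (auto simp: monic_orthogonal_def)
  qed
  then have "?R = 0" unfolding A by simp
  then show ?case by simp
qed

lemma monic_orthogonal_mop: "monic_orthogonal a b W (mop a b W)"
proof -
  have "\<exists>!Q. monic_orthogonal a b W Q"
  proof (rule ex_ex1I)
    show "\<exists>Q. monic_orthogonal a b W Q" by (rule ex_monic_orthogonal)
  next
    fix Q Q'
    assume "monic_orthogonal a b W Q" "monic_orthogonal a b W Q'"
    then show "Q = Q'"
      using monic_orthogonal_unique by blast
  qed
  then show ?thesis
    unfolding mop_def by (rule theI')
qed

lemma monic_mop: "monic_of_degree w (mop a b W w)"
  using monic_orthogonal_mop by (simp add: monic_orthogonal_def)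

lemma mop_expansion: "\<exists>w A. P = (\<Sum>j<w. const_mpoly (A j) ** mop a b W j)"
proof -
  obtain w where "\<forall>m\<ge>w. mcoeff P m = 0"
    using finite_mdegree by blast
  then show ?thesis
    using monic_expansion[of w "mop a b W" P] monic_mop by blast
qed

text \<open>Comparing leading coefficients makes the eigenvalue unique, so the description in
  \<open>Lam\<close> denotes it.\<close>

lemma DW_Lam:
  assumes "D \<in> DW a b W"
  shows "D (mop a b W w) = const_mpoly (Lam a b W w D) ** mop a b W w"
  unfolding Lam_def
proof (rule theI')
  show "\<exists>!L. D (mop a b W w) = const_mpoly L ** mop a b W w"
  proof (rule ex_ex1I)
    show "\<exists>L. D (mop a b W w) = const_mpoly L ** mop a b W w"
      using assms by (simp add: DW_def)
    show "L = L'" if "D (mop a b W w) = const_mpoly L ** mop a b W w"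
      "D (mop a b W w) = const_mpoly L' ** mop a b W w" for L L'
      using that by (intro monic_const_mult_cancel[OF monic_mop[of w]]) simp
  qed
qed

end

section \<open>Operators with scalar eigenvalues\<close>

lemma mderiv_add: "mderiv (P + Q) = mderiv P + mderiv Q"
  by (simp add: mderiv_def vec_eq_iff pderiv_add)

lemma pderiv_sum: "pderiv (\<Sum>i\<in>S. f i) = (\<Sum>i\<in>S. pderiv (f i))"
  by (induction S rule: infinite_finite_induct) (simp_all add: pderiv_add)

lemma mderiv_const_mult: "mderiv (const_mpoly A ** P) = const_mpoly A ** mderiv P"
  by (simp add: mderiv_def const_mpoly_def vec_eq_iff matrix_matrix_mult_def pderiv_sum pderiv_smult)

lemma weyl_algebra_add:
  assumes "D \<in> weyl_algebra"
  shows "D (P + Q) = D P + D Q"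
proof -
  have "(mderiv ^^ i) (P + Q) = (mderiv ^^ i) P + (mderiv ^^ i) Q" for i
    by (induction i) (simp_all add: mderiv_add)
  then show ?thesis
    using assms by (auto simp: weyl_algebra_def weyl_op_def matrix_add_rdistrib sum.distrib)
qed

text \<open>Derivatives ignore constant factors on the left, and the coefficients of the operator
  multiply on the right, so the two do not interfere.\<close>

lemma weyl_algebra_const_mult:
  assumes "D \<in> weyl_algebra"
  shows "D (const_mpoly A ** P) = const_mpoly A ** D P"
proof -
  have "(mderiv ^^ i) (const_mpoly A ** P) = const_mpoly A ** (mderiv ^^ i) P" for i
    by (induction i) (simp_all add: mderiv_const_mult)
  then show ?thesis
    using assms by (auto simp: weyl_algebra_def weyl_op_def matrix_sum_ldistrib matrix_mul_assoc)
qed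

lemma weyl_algebra_sum:
  assumes "D \<in> weyl_algebra"
  shows "D (\<Sum>i\<in>S. const_mpoly (A i) ** P i) = (\<Sum>i\<in>S. const_mpoly (A i) ** D (P i))"
proof -
  have "D 0 = 0"
    using weyl_algebra_const_mult[OF assms, of 0 0] by simp
  then show ?thesis
    by (induction S rule: infinite_finite_induct)
       (simp_all add: weyl_algebra_add[OF assms] weyl_algebra_const_mult[OF assms])
qed

lemma DW_subset_weyl: "DW a b W \<subseteq> weyl_algebra"
  by (auto simp: DW_def)

lemma DW_commute:
  assumes weight: "weight_matrix a b W" and "C \<in> DW a b W" "D \<in> DW a b W"
    and scalar: "\<And>n. scalar_matrix (Lam a b W n C)"
  shows "weyl_mult D C = weyl_mult C D"
proof
  fix P
  let ?Q = "mop a b W" and ?L = "\<lambda>E j. Lam a b W j E"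
  have weyl: "C \<in> weyl_algebra" "D \<in> weyl_algebra"
    using assms DW_subset_weyl by blast+
  \<comment> \<open>By left linearity, applying \<open>D\<close> and then \<open>C\<close> to
    \<open>?Q j\<close> yields the eigenvalue \<open>?L D j ** ?L C j\<close>; the opposite order
    swaps the factors.\<close>
  have "?L D j ** ?L C j = ?L C j ** ?L D j" for j
    using scalar[of j] by (auto simp: scalar_matrix_def mat_commute)
  then have "C (D (?Q j)) = D (C (?Q j))" for j
    by (simp add: DW_Lam[OF weight] assms weyl_algebra_const_mult weyl matrix_mul_assoc
        flip: const_mpoly_mult)
  moreover obtain w A where "P = (\<Sum>j<w. const_mpoly (A j) ** ?Q j)"
    using mop_expansion[OF weight] by blast
  ultimately show "weyl_mult D C P = weyl_mult C D P"
    by (simp add: weyl_mult_def weyl(1,2)[THEN weyl_algebra_sum])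
qed

text \<open>An operator commuting with \<open>C\<close> maps each eigenvector of \<open>C\<close> to
  one with the same scalar eigenvalue, and distinct eigenvalues confine the image to left multiples
  of \<open>?Q n\<close>.\<close>

lemma commuting_in_DW:
  assumes weight: "weight_matrix a b W" and C: "C \<in> DW a b W"
    and scalar: "\<And>n. scalar_matrix (Lam a b W n C)"
    and distinct: "\<And>k j. Lam a b W k C = Lam a b W j C \<Longrightarrow> k = j"
    and D: "D \<in> weyl_algebra" and commute: "weyl_mult D C = weyl_mult C D"
  shows "D \<in> DW a b W"
proof -
  let ?Q = "mop a b W"
  obtain c where c: "\<And>n. Lam a b W n C = mat (c n)"
    using scalar unfolding scalar_matrix_def by metis
  have CQ: "C (?Q n) = const_mpoly (mat (c n)) ** ?Q n" for n
    using DW_Lam[OF weight C] c by simp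
  have weyl: "C \<in> weyl_algebra"
    using C DW_subset_weyl by blast
  have "\<exists>L. D (?Q n) = const_mpoly L ** ?Q n" for n
  proof -
    obtain w A where A: "D (?Q n) = (\<Sum>j<w. const_mpoly (A j) ** ?Q j)"
      using mop_expansion[OF weight] by blast
    have "C (D (?Q n)) = D (C (?Q n))"
      using fun_cong[OF commute, of "?Q n"] by (simp add: weyl_mult_def)
    \<comment> \<open>\<open>C\<close> produces \<open>A j ** mat (c j)\<close>; the scalar moves to
      the left so that both expansions can be compared term by term.\<close>
    moreover have "C (D (?Q n)) = (\<Sum>j<w. const_mpoly (mat (c j) ** A j) ** ?Q j)"
      by (simp add: A weyl_algebra_sum[OF weyl] CQ matrix_mul_assoc mat_commute flip: const_mpoly_mult)
    moreover have "D (C (?Q n)) = (\<Sum>j<w. const_mpoly (mat (c n) ** A j) ** ?Q j)"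
      by (simp add: CQ weyl_algebra_const_mult[OF D] A matrix_sum_ldistrib matrix_mul_assoc const_mpoly_mult)
    ultimately have
      "(\<Sum>j<w. const_mpoly (mat (c j) ** A j - mat (c n) ** A j) ** ?Q j) = 0"
      by (simp add: const_mpoly_diff matrix_diff_rdistrib sum_subtractf)
    then have diff: "mat (c j) ** A j - mat (c n) ** A j = 0" if "j < w" for j
      using that monic_mop[OF weight] by (intro monic_independent[of w ?Q]) auto
    have A0: "A j = 0" if "j < w" "j \<noteq> n" for j
    proof -
      have "mat (c j - c n) ** A j = 0"
        using diff[OF that(1)]
        by (simp add: vec_eq_iff matrix_matrix_mult_def mat_def if_distrib if_distribR
            left_diff_distrib cong: if_cong)
      moreover have "c j \<noteq> c n"
        using distinct that(2) c by metis
      ultimately show ?thesis using mat_mult_eq_0 by (metis right_minus_eq)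
    qed
    \<comment> \<open>The intersection covers \<open>n \<ge> w\<close> as well: it is then empty,
      and the eigenvalue is zero.\<close>
    have "D (?Q n) = (\<Sum>j\<in>{..<w} \<inter> {n}. const_mpoly (A j) ** ?Q j)"
      unfolding A using A0 by (intro sum.mono_neutral_right) auto
    also have "\<dots> = const_mpoly (if n < w then A n else 0) ** ?Q n"
      by auto
    finally show ?thesis by blast
  qed
  with D show ?thesis by (simp add: DW_def)
qed

theorem theorem7p1:
  fixes a b :: ereal and W :: "real \<Rightarrow> complex ^ 'n::finite ^ 'n" and C :: "'n operator"
  assumes "weight_matrix a b W"
    and "C \<in> DW a b W"
    and "\<And>n. scalar_matrix (Lam a b W n C)"
    and "\<And>k j. Lam a b W k C = Lam a b W j C \<Longrightarrow> k = j"
  shows "weyl_centralizer {C} = DW a b W \<and> weyl_centralizer (ZW a b W) = DW a b W"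
proof -
  note commute = DW_commute[OF assms(1,2) _ assms(3)]
  have cent: "weyl_centralizer {C} = DW a b W"
    using commute commuting_in_DW[OF assms] DW_subset_weyl[of a b W]
    by (auto simp: weyl_centralizer_def)
  have "C \<in> ZW a b W"
    using assms(2) commute by (auto simp: ZW_def)
  \<comment> \<open>Centralizers reverse inclusions, and \<open>C\<close> is central in
    \<open>DW a b W\<close>.\<close>
  then have "weyl_centralizer (ZW a b W) \<subseteq> weyl_centralizer {C}"
    by (auto simp: weyl_centralizer_def)
  moreover have "DW a b W \<subseteq> weyl_centralizer (ZW a b W)"
    using DW_subset_weyl[of a b W] by (auto simp: weyl_centralizer_def ZW_def)
  ultimately show ?thesis
    using cent by blast
qed

end
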